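(* Let $n,d,B,K\ge 1$ be integers, let $f_1,\dots,f_n,h:\mathbb{R}^d\to\mathbb{R}$ be continuously differentiable, and put $F:=\frac1n\sum_{i=1}^n f_i$ and $\psi:=F+h$. Assume that $f_i$ is $L_i$-smooth for each $i=1,\dots,n$, that $h$ is $L_h$-smooth, and that $\psi$ is $\lambda$-strongly convex, where $L_1,\dots,L_n,L_h,\lambda>0$. Let $\boldsymbol{x}^*$ be the minimizer of $\psi$ over $\mathbb{R}^d$. Let $p_1,\dots,p_n>0$ with $\sum_{i=1}^n p_i=1$, and define $$s_F:=\frac{2}{B\lambda^2 n}\sum_{i=1}^{n}\frac{L_i^2}{np_i},\qquad \sigma_F:=\frac1B\left(\frac1n\sum_{i=1}^n\frac{1}{np_i}\|\nabla f_i(\boldsymbol{x}^* )\|_2^2-\|\nabla F(\boldsymbol{x}^* )\|_2^2\right).$$ Let $\{\boldsymbol{x}_k\}_{k=1}^{K+1}$ be the sequence generated from a (deterministic) initial point $\boldsymbol{x}_1\in\mathbb{R}^d$ by mini-batch SGD with batch size $B$, sampling probabilities $p_1,\dots,p_n$ and constant step size $\eta$ satisfying $$0<\eta\le\frac{2}{(s_F+1)\left(\frac1n\sum_{i=1}^n L_i+L_h+\lambda\right)}.$$ Define $$q:=\frac{2\eta\lambda\left(\frac1n\sum_{i=1}^n L_i+L_h\right)}{\frac1n\sum_{i=1}^n L_i+L_h+\lambda},\qquad R:=\frac{2\eta^2\sigma_F}{q}.$$ Then $q\in(0,1)$ and $$\mathbb{E}\left[\|\boldsymbol{x}_{K+1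}-\boldsymbol{x}^*\|_2^2\right]\le(1-q)^K\|\boldsymbol{x}_1-\boldsymbol{x}^*\|_2^2+R.$$
   Context: A continuously differentiable function $g:\mathbb{R}^d\to\mathbb{R}$ is called $L$-smooth ($L>0$) if $\|\nabla g(\boldsymbol{x})-\nabla g(\boldsymbol{y})\|_2\le L\|\boldsymbol{x}-\boldsymbol{y}\|_2$ for all $\boldsymbol{x},\boldsymbol{y}\in\mathbb{R}^d$, and $\lambda$-strongly convex ($\lambda>0$) if $\boldsymbol{x}\mapsto g(\boldsymbol{x})-\frac{\lambda}{2}\|\boldsymbol{x}\|_2^2$ is convex. Mini-batch SGD with batch size $B$, sampling probabilities $p_1,\dots,p_n$ and step size $\eta$ is the following iteration. For each $k=1,\dots,K$, let $\xi_{k,1},\dots,\xi_{k,B}$ be independent random variables with values in $\{1,\dots,n\}$ and $\mathbb{P}(\xi_{k,j}=i)=p_i$ for all $i,j$, drawn independently of $\boldsymbol{x}_1,\dots,\boldsymbol{x}_k$. Set $$\boldsymbol{g}_k=\frac1B\sum_{j=1}^B\frac{1}{n p_{\xi_{k,j}}}\nabla f_{\xi_{k,j}}(\boldsymbol{x}_k),\qquad \boldsymbol{x}_{k+1}=\boldsymbol{x}_k-\eta\left(\boldsymbol{g}_k+\nabla h(\boldsymbol{x}_k)\right).$$ *)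

theory Defs
  imports "HOL-Probability.Probability"
begin

definition grad :: "('a::euclidean_space \<Rightarrow> real) \<Rightarrow> 'a \<Rightarrow> 'a" where
  "grad f x = (THE D. GDERIV f x :> D)"

lemma GDERIV_unique:
  assumes "GDERIV f x :> D" "GDERIV f x :> E"
  shows "D = E"
proof -
  have "(\<lambda>h. inner h D) = (\<lambda>h. inner h E)"
    using assms unfolding gderiv_def by (rule has_derivative_unique)
  then have "inner h D = inner h E" for h
    by metis
  then show ?thesis
    by (metis vector_eq_ldot)
qed

lemma grad_eqI: "GDERIV f x :> D \<Longrightarrow> grad f x = D"
  unfolding grad_def by (rule the_equality) (auto intro: GDERIV_unique)

lemma GDERIV_grad:
  fixes f :: "'a::euclidean_space \<Rightarrow> real"
  assumes "f differentiable (at x)"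
  shows "GDERIV f x :> grad f x"
proof -
  obtain f' where f': "(f has_derivative f') (at x)"
    using assms by (auto simp: differentiable_def)
  then have lin: "linear f'"
    by (rule has_derivative_linear)
  have "f' h = inner h (\<Sum>b\<in>Basis. f' b *\<^sub>R b)" for h
  proof -
    have "f' h = f' (\<Sum>b\<in>Basis. inner h b *\<^sub>R b)"
      by (simp add: euclidean_representation)
    also have "\<dots> = (\<Sum>b\<in>Basis. inner h b * f' b)"
      using lin by (simp add: linear_sum linear_scale)
    also have "\<dots> = inner h (\<Sum>b\<in>Basis. f' b *\<^sub>R b)"
      by (simp add: inner_sum_right mult.commute)
    finally show ?thesis .
  qed
  then have "f' = (\<lambda>h. inner h (\<Sum>b\<in>Basis. f' b *\<^sub>R b))"
    by blast
  then have "GDERIV f x :> (\<Sum>b\<in>Basis. f' b *\<^sub>R b)"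
    using f' unfolding gderiv_def by metis
  then show ?thesis
    using grad_eqI by metis
qed

definition cont_diff :: "('a::euclidean_space \<Rightarrow> real) \<Rightarrow> bool" where
  "cont_diff f \<longleftrightarrow> (\<forall>x. f differentiable (at x)) \<and> continuous_on UNIV (grad f)"

definition smooth_fun :: "real \<Rightarrow> ('a::euclidean_space \<Rightarrow> real) \<Rightarrow> bool" where
  "smooth_fun L g \<longleftrightarrow>
     0 < L \<and> cont_diff g \<and> (\<forall>x y. norm (grad g x - grad g y) \<le> L * norm (x - y))"

definition strongly_convex :: "real \<Rightarrow> ('a::euclidean_space \<Rightarrow> real) \<Rightarrow> bool" where
  "strongly_convex l g \<longleftrightarrow>
     0 < l \<and> cont_diff g \<and> convex_on UNIV (\<lambda>x. g x - l / 2 * (norm x)\<^sup>2)"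

(* The library's indep_var requires both variables to have the same value type;
   this is its definition (independence of the generated sigma-algebras) without
   that restriction. *)
definition indep_rv ::
    "'w measure \<Rightarrow> 'a measure \<Rightarrow> ('w \<Rightarrow> 'a) \<Rightarrow> 'b measure \<Rightarrow> ('w \<Rightarrow> 'b) \<Rightarrow> bool" where
  "indep_rv M N X N' Y \<longleftrightarrow>
     X \<in> measurable M N \<and> Y \<in> measurable M N' \<and>
     prob_space.indep_set M {X -` A \<inter> space M | A. A \<in> sets N}
                            {Y -` A \<inter> space M | A. A \<in> sets N'}"

definition minibatch_gradient ::
    "nat \<Rightarrow> nat \<Rightarrow> (nat \<Rightarrow> real) \<Rightarrow> (nat \<Rightarrow> 'a::euclidean_space \<Rightarrow> real) \<Rightarrow> (nat \<Rightarrow> nat) \<Rightarrow> 'a \<Rightarrow> 'a"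
  where
  "minibatch_gradient n B p f i y =
     (1 / real B) *\<^sub>R (\<Sum>j=1..B. (1 / (real n * p (i j))) *\<^sub>R grad (f (i j)) y)"

(* \<xi> k j is the j-th index sampled in step k, and x k the k-th iterate, both as
   random variables on the probability space M.  Functions of an index are only
   constrained on the relevant ranges: f and p on {1..n}, \<xi> on {1..K} and {1..B},
   x on {1..K+1}.  Membership of \<xi> k j in {1..n} is part of the measurability
   into count_space {1..n} that indep_vars includes.  The independence of step k from
   the past is that of the whole batch (\<xi> k 1, ..., \<xi> k B) from (x 1, ..., x k). *)
definition minibatch_sgd ::
    "'w measure \<Rightarrow> nat \<Rightarrow> nat \<Rightarrow> nat \<Rightarrow> (nat \<Rightarrow> real) \<Rightarrow> real \<Rightarrow>
     (nat \<Rightarrow> 'a::euclidean_space \<Rightarrow> real) \<Rightarrow> ('a \<Rightarrow> real) \<Rightarrow> 'a \<Rightarrow>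
     (nat \<Rightarrow> nat \<Rightarrow> 'w \<Rightarrow> nat) \<Rightarrow> (nat \<Rightarrow> 'w \<Rightarrow> 'a) \<Rightarrow> bool" where
  "minibatch_sgd M n B K p \<eta> f h x1 \<xi> x \<longleftrightarrow>
     prob_space M \<and>
     (\<forall>\<omega>\<in>space M. x 1 \<omega> = x1) \<and>
     (\<forall>k\<in>{1..K}.
        prob_space.indep_vars M (\<lambda>_. count_space {1..n}) (\<xi> k) {1..B} \<and>
        (\<forall>j\<in>{1..B}. \<forall>i\<in>{1..n}. measure M {\<omega>\<in>space M. \<xi> k j \<omega> = i} = p i) \<and>
        indep_rv M
          (PiM {1..B} (\<lambda>_. count_space {1..n})) (\<lambda>\<omega>. \<lambda>j\<in>{1..B}. \<xi> k j \<omega>)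
          (PiM {1..k} (\<lambda>_. borel)) (\<lambda>\<omega>. \<lambda>l\<in>{1..k}. x l \<omega>) \<and>
        (\<forall>\<omega>\<in>space M.
           x (k + 1) \<omega> =
             x k \<omega> - \<eta> *\<^sub>R (minibatch_gradient n B p f (\<lambda>j. \<xi> k j \<omega>) (x k \<omega>) + grad h (x k \<omega>))))"

end

theory Submission
  imports Defs
begin

text \<open>For \<open>\<psi>\<close> that is \<open>lam\<close>-strongly convex with \<open>L\<close>-Lipschitz gradient \<open>G\<close>, cocoercivity of the
  gradient of \<open>\<psi> - lam / 2 * (norm x)\<^sup>2\<close> yields the bound
  \<open>(norm (G x))\<^sup>2 + lam * L * (norm (x - x_star))\<^sup>2 \<le> (L + lam) * inner (G x) (x - x_star)\<close>.
  Given \<open>x k\<close>, the expected squared error after one step is that of the exact gradient step plus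
  \<open>\<eta>\<^sup>2\<close> times the variance of the mini-batch gradient at \<open>x k\<close>. That variance is at most twice the
  variance at \<open>x_star\<close> plus \<open>s * lam\<^sup>2 * (norm (x k - x_star))\<^sup>2\<close>, and the second part is at most
  \<open>s * (norm (G (x k)))\<^sup>2\<close> by strong convexity, which the step size restriction allows to absorb.
  Hence the expected squared error contracts by \<open>1 - q\<close> up to the additive term \<open>q * R\<close>.\<close>

section \<open>Gradients of smooth and strongly convex functions\<close>

text \<open>The chain rule along a line, through which the bounds below reduce to calculus in one
  real variable.\<close>

lemma GDERIV_along_line:
  assumes "GDERIV g (y + t *\<^sub>R d) :> D"
  shows "((\<lambda>t. g (y + t *\<^sub>R d)) has_real_derivative inner D d) (at t)"
proof -
  have "((\<lambda>t. y + t *\<^sub>R d) has_derivative (\<lambda>s. s *\<^sub>R d)) (at t)"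
    by (auto intro!: derivative_eq_intros)
  moreover have "(g has_derivative (\<lambda>h. inner h D)) (at (y + t *\<^sub>R d))"
    using assms by (simp add: gderiv_def)
  ultimately have "((\<lambda>t. g (y + t *\<^sub>R d)) has_derivative (\<lambda>s. inner (s *\<^sub>R d) D)) (at t)"
    by (rule has_derivative_compose)
  then show ?thesis
    by (simp add: has_field_derivative_def inner_commute mult.commute[of _ "inner D d"])
qed

lemma smooth_fun_GDERIV: "smooth_fun L g \<Longrightarrow> GDERIV g x :> grad g x"
  by (auto simp: smooth_fun_def cont_diff_def intro: GDERIV_grad)

text \<open>The descent lemma without integrals: along the segment from \<open>y\<close> to
  \<open>z\<close>, the difference between \<open>g\<close> and the claimed bound has nonpositive
  derivative, by Cauchy-Schwarz and the Lipschitz condition.\<close>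

lemma quadratic_upper_bound:
  fixes g :: "'a::real_inner \<Rightarrow> real"
  assumes deriv: "\<And>x. GDERIV g x :> D x"
    and lip: "\<And>x y. norm (D x - D y) \<le> L * norm (x - y)"
  shows "g z \<le> g y + inner (D y) (z - y) + L / 2 * (norm (z - y))\<^sup>2"
proof -
  define d where "d = z - y"
  define k where "k t = g (y + t *\<^sub>R d) - t * inner (D y) d - L / 2 * t\<^sup>2 * (norm d)\<^sup>2" for t
  have "\<exists>c. (k has_real_derivative c) (at t) \<and> c \<le> 0" if "0 \<le> t" for t
  proof (intro exI conjI)
    show "(k has_real_derivative (inner (D (y + t *\<^sub>R d)) d - inner (D y) d - L * t * (norm d)\<^sup>2)) (at t)"
      unfolding k_def
      by (rule derivative_eq_intros refl GDERIV_along_line deriv | simp)+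
    have "inner (D (y + t *\<^sub>R d) - D y) d \<le> norm (D (y + t *\<^sub>R d) - D y) * norm d"
      by (rule norm_cauchy_schwarz)
    also have "\<dots> \<le> (L * norm (t *\<^sub>R d)) * norm d"
      using lip[of "y + t *\<^sub>R d" y] by (intro mult_right_mono) auto
    also have "\<dots> = L * t * (norm d)\<^sup>2"
      using that by (simp add: power2_eq_square)
    finally show "inner (D (y + t *\<^sub>R d)) d - inner (D y) d - L * t * (norm d)\<^sup>2 \<le> 0"
      by (simp add: inner_diff_left)
  qed
  then have "k 1 \<le> k 0"
    by (intro DERIV_nonpos_imp_nonincreasing[of 0 1 k]) simp_all
  then show ?thesis
    by (simp add: k_def d_def)
qed

text \<open>Restricted to the line through \<open>y\<close> and \<open>z\<close>, \<open>g\<close>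
  is a convex function of one variable and lies above its tangent at \<open>0\<close>.\<close>

lemma convex_on_above_gradient:
  fixes g :: "'a::real_inner \<Rightarrow> real"
  assumes "convex_on UNIV g" "GDERIV g y :> D"
  shows "g y + inner D (z - y) \<le> g z"
proof -
  define k where "k t = g (y + t *\<^sub>R (z - y))" for t
  have "convex_on UNIV k"
  proof (rule convex_onI)
    fix t a b :: real
    assume "0 < t" "t < 1"
    moreover have "y + ((1 - t) *\<^sub>R a + t *\<^sub>R b) *\<^sub>R (z - y)
        = (1 - t) *\<^sub>R (y + a *\<^sub>R (z - y)) + t *\<^sub>R (y + b *\<^sub>R (z - y))"
      by (simp add: algebra_simps)
    ultimately show "k ((1 - t) *\<^sub>R a + t *\<^sub>R b) \<le> (1 - t) * k a + t * k b"
      unfolding k_def using convex_onD[OF assms(1), of t] by auto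
  qed simp
  moreover have "(k has_real_derivative inner D (z - y)) (at 0)"
    unfolding k_def using assms(2) by (intro GDERIV_along_line) simp
  ultimately have "k 1 - k 0 \<ge> inner D (z - y) * (1 - 0)"
    by (intro convex_on_imp_above_tangent[where A = UNIV]) auto
  then show ?thesis
    by (simp add: k_def)
qed

text \<open>This is the tangent inequality for the convex function
  \<open>g x - l / 2 * (norm x)\<^sup>2\<close>; the squared norms recombine into
  \<open>(norm (z - y))\<^sup>2\<close>.\<close>

lemma strongly_convex_lower_bound:
  assumes "strongly_convex l g"
  shows "g y + inner (grad g y) (z - y) + l / 2 * (norm (z - y))\<^sup>2 \<le> g z"
proof -
  have "GDERIV g y :> grad g y"
    using assms by (auto simp: strongly_convex_def cont_diff_def intro: GDERIV_grad)
  then have "GDERIV (\<lambda>x. g x - l / 2 * (norm x)\<^sup>2) y :> grad g y - l *\<^sub>R y"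
    unfolding gderiv_def power2_norm_eq_inner
    by (auto intro!: derivative_eq_intros simp: inner_diff_right inner_commute algebra_simps)
  then have "(g y - l / 2 * (norm y)\<^sup>2) + inner (grad g y - l *\<^sub>R y) (z - y)
      \<le> g z - l / 2 * (norm z)\<^sup>2"
    using assms convex_on_above_gradient by (auto simp: strongly_convex_def)
  then show ?thesis
    by (simp add: power2_norm_eq_inner algebra_simps inner_commute)
qed

text \<open>The lower bound at \<open>x\<close> and the upper bound at \<open>y\<close> are compared at the gradient step
  \<open>y - t (D y - D x)\<close>; the choice \<open>t = 1 / c\<close> is optimal, and for \<open>c = 0\<close> one lets \<open>t\<close> grow.\<close>
lemma gradient_cocoercive:
  fixes g :: "'a::real_inner \<Rightarrow> real"
  assumes low: "\<And>y z. g y + inner (D y) (z - y) \<le> g z"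
    and upp: "\<And>y z. g z \<le> g y + inner (D y) (z - y) + c / 2 * (norm (z - y))\<^sup>2"
    and "0 \<le> c"
  shows "(norm (D x - D y))\<^sup>2 \<le> c * inner (D x - D y) (x - y)"
proof -
  define N where "N = (norm (D x - D y))\<^sup>2"
  define P where "P = inner (D x - D y) (x - y)"
  have half: "g x - g y + inner (D x) (y - x) \<le> (c / 2 * t\<^sup>2 - t) * (norm (D x - D y))\<^sup>2" for x y t
  proof -
    define z where "z = y - t *\<^sub>R (D y - D x)"
    have "g x + inner (D x) (z - x) \<le> g y + inner (D y) (z - y) + c / 2 * (norm (z - y))\<^sup>2"
      using low[of x z] upp[of z y] by linarith
    moreover have "inner (D x) (z - x) = inner (D x) (y - x) + inner (D x) (z - y)"
      by (simp add: inner_diff_right)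
    moreover have "inner (D y) (z - y) - inner (D x) (z - y) = - t * (norm (D x - D y))\<^sup>2"
      unfolding z_def power2_norm_eq_inner by (simp add: algebra_simps inner_commute)
    moreover have "(norm (z - y))\<^sup>2 = t\<^sup>2 * (norm (D x - D y))\<^sup>2"
      unfolding z_def by (simp add: power_mult_distrib norm_minus_commute)
    ultimately show ?thesis
      by (simp add: algebra_simps)
  qed
  \<comment> \<open>Adding the two instances of \<open>half\<close> with \<open>x\<close> and
    \<open>y\<close> exchanged cancels the function values.\<close>
  have bound: "(2 * t - c * t\<^sup>2) * N \<le> P" for t
    using half[of x y t] half[of y x t]
    unfolding N_def P_def by (simp add: norm_minus_commute algebra_simps inner_commute)
  have "0 \<le> N" by (simp add: N_def)
  have "N \<le> c * P"
  proof (cases "c = 0")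
    case True
    have "N = 0"
    proof (rule ccontr)
      assume "N \<noteq> 0"
      \<comment> \<open>With \<open>c = 0\<close>, this value of \<open>t\<close> turns
        \<open>bound\<close> into \<open>P + 1 \<le> P\<close>.\<close>
      then show False
        using bound[of "(P + 1) / (2 * N)"] True by simp
    qed
    then show ?thesis using True by simp
  next
    case False
    then show ?thesis
      using bound[of "1 / c"] \<open>0 \<le> c\<close> by (simp add: power2_eq_square field_simps)
  qed
  then show ?thesis by (simp add: N_def P_def)
qed

lemma strongly_convex_gradient_monotone:
  assumes "strongly_convex l g"
  shows "l * (norm (x - y))\<^sup>2 \<le> inner (grad g x - grad g y) (x - y)"
  using strongly_convex_lower_bound[OF assms, of x y] strongly_convex_lower_bound[OF assms, of y x]
  by (simp add: norm_minus_commute algebra_simps inner_commute)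

text \<open>Monotonicity combined with Cauchy-Schwarz. Its role is to trade distances to the
  minimizer for gradient norms.\<close>

lemma strongly_convex_gradient_expansive:
  assumes "strongly_convex l g"
  shows "l * norm (x - y) \<le> norm (grad g x - grad g y)"
proof (cases "x = y")
  case False
  have "(l * norm (x - y)) * norm (x - y) \<le> norm (grad g x - grad g y) * norm (x - y)"
    using strongly_convex_gradient_monotone[OF assms, of x y]
      norm_cauchy_schwarz[of "grad g x - grad g y" "x - y"]
    by (simp add: power2_eq_square)
  then show ?thesis using False by simp
qed simp

text \<open>Subtracting the quadratic leaves a convex function \<open>\<phi>\<close> whose quadratic
  upper bound has constant \<open>L - l\<close>. Cocoercivity of its gradient, rewritten in terms of
  \<open>grad g\<close>, is the claim.\<close>

lemma smooth_strongly_convex_gradient: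
  assumes sc: "strongly_convex l g"
    and lip: "\<And>x y. norm (grad g x - grad g y) \<le> L * norm (x - y)"
  shows "(norm (grad g x - grad g y))\<^sup>2 + l * L * (norm (x - y))\<^sup>2
           \<le> (L + l) * inner (grad g x - grad g y) (x - y)"
proof (cases "x = y")
  case False
  \<comment> \<open>Cocoercivity needs \<open>0 \<le> L - l\<close>. This follows by comparing both
    bounds at two distinct points, hence the case split.\<close>
  have "l * norm (x - y) \<le> L * norm (x - y)"
    using strongly_convex_gradient_expansive[OF sc, of x y] lip[of x y] by linarith
  then have "l \<le> L" using False by simp
  have deriv: "GDERIV g x :> grad g x" for x
    using sc by (auto simp: strongly_convex_def cont_diff_def intro: GDERIV_grad)
  define \<phi> where "\<phi> x = g x - l / 2 * (norm x)\<^sup>2" for x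
  define D where "D x = grad g x - l *\<^sub>R x" for x
  have "(norm (D x - D y))\<^sup>2 \<le> (L - l) * inner (D x - D y) (x - y)"
  proof (rule gradient_cocoercive)
    fix y z
    show "\<phi> y + inner (D y) (z - y) \<le> \<phi> z"
      using strongly_convex_lower_bound[OF sc, of y z]
      by (simp add: \<phi>_def D_def power2_norm_eq_inner algebra_simps inner_commute)
    show "\<phi> z \<le> \<phi> y + inner (D y) (z - y) + (L - l) / 2 * (norm (z - y))\<^sup>2"
      using quadratic_upper_bound[OF deriv lip, of z y]
      by (simp add: \<phi>_def D_def power2_norm_eq_inner field_simps inner_commute inner_diff_right inner_diff_left)
  qed (use \<open>l \<le> L\<close> in simp)
  moreover have "D x - D y = (grad g x - grad g y) - l *\<^sub>R (x - y)"
    by (simp add: D_def algebra_simps)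
  moreover define G v where "G = grad g x - grad g y" and "v = x - y"
  ultimately have "(norm (G - l *\<^sub>R v))\<^sup>2 \<le> (L - l) * inner (G - l *\<^sub>R v) v"
    by (simp only:)
  \<comment> \<open>After both expansions the terms with \<open>l * l\<close> cancel, and
    \<open>2 * l * inner G v\<close> raises the factor \<open>L - l\<close> to
    \<open>L + l\<close>.\<close>
  moreover have "(norm (G - l *\<^sub>R v))\<^sup>2 = (norm G)\<^sup>2 - 2 * l * inner G v + l * l * (norm v)\<^sup>2"
    unfolding power2_norm_eq_inner by (simp add: algebra_simps inner_commute)
  moreover have "inner (G - l *\<^sub>R v) v = inner G v - l * (norm v)\<^sup>2"
    unfolding power2_norm_eq_inner by (simp add: algebra_simps)
  ultimately have "(norm G)\<^sup>2 + l * L * (norm v)\<^sup>2 \<le> (L + l) * inner G v"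
    by (simp only: left_diff_distrib right_diff_distrib distrib_right mult.assoc mult.left_commute[of l L])
  then show ?thesis
    by (simp add: G_def v_def)
qed simp

section \<open>First-order optimality and second moments in inner product spaces\<close>

lemma grad_eq_0_at_minimum:
  assumes "g differentiable (at x)" "is_arg_min g (\<lambda>_. True) x"
  shows "grad g x = 0"
proof -
  have "(g has_derivative (\<lambda>h. inner h (grad g x))) (at x)"
    using GDERIV_grad[OF assms(1)] by (simp add: gderiv_def)
  moreover have "\<forall>y\<in>UNIV. g x \<le> g y"
    using assms(2) by (auto simp: is_arg_min_def not_less)
  ultimately have "(\<lambda>h. inner h (grad g x)) = (\<lambda>h. 0)"
    using differential_zero_maxmin[of x UNIV g] by blast
  then have "inner (grad g x) (grad g x) = 0" by metis
  then show ?thesis by simp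
qed

text \<open>Variance is second moment minus squared mean. In particular, centering never increases
  the weighted sum of squares.\<close>

lemma sum_weighted_centered_norm_sq:
  fixes u :: "'b \<Rightarrow> 'a::real_inner"
  assumes "sum p I = 1" and m: "m = (\<Sum>i\<in>I. p i *\<^sub>R u i)"
  shows "(\<Sum>i\<in>I. p i * (norm (u i - m))\<^sup>2) = (\<Sum>i\<in>I. p i * (norm (u i))\<^sup>2) - (norm m)\<^sup>2"
proof -
  have "p i * (norm (u i - m))\<^sup>2
      = p i * (norm (u i))\<^sup>2 - 2 * inner (p i *\<^sub>R u i) m + p i * (norm m)\<^sup>2" for i
    by (simp add: power2_norm_eq_inner algebra_simps inner_commute)
  then have "(\<Sum>i\<in>I. p i * (norm (u i - m))\<^sup>2)
      = (\<Sum>i\<in>I. p i * (norm (u i))\<^sup>2) - 2 * inner (\<Sum>i\<in>I. p i *\<^sub>R u i) m + sum p I * (norm m)\<^sup>2"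
    by (simp add: sum.distrib sum_subtractf sum_distrib_left sum_distrib_right inner_sum_left)
  then show ?thesis
    using assms by (simp add: power2_norm_eq_inner)
qed

lemma norm_add_sq_le:
  fixes a b :: "'a::real_inner"
  shows "(norm (a + b))\<^sup>2 \<le> 2 * (norm a)\<^sup>2 + 2 * (norm b)\<^sup>2"
proof -
  have "0 \<le> (norm (a - b))\<^sup>2" by simp
  then show ?thesis
    unfolding power2_norm_eq_inner by (simp add: algebra_simps inner_commute)
qed

section \<open>Finitely valued random variables\<close>

lemma measurable_count_space_level_set:
  assumes "X \<in> measurable M (count_space I)" "a \<in> I"
  shows "{\<omega> \<in> space M. X \<omega> = a} \<in> sets M"
proof -
  have "X -` {a} \<inter> space M \<in> sets M"
    using assms by (auto intro: measurable_sets)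
  moreover have "X -` {a} \<inter> space M = {\<omega> \<in> space M. X \<omega> = a}" by auto
  ultimately show ?thesis by simp
qed

text \<open>The extra argument \<open>c\<close> is later instantiated with the value of a second
  random variable at the same \<open>\<omega>\<close>.\<close>

lemma finite_range_indicator_sum:
  fixes \<Phi> :: "'b \<Rightarrow> 'c \<Rightarrow> real"
  assumes "finite I" "X \<in> measurable M (count_space I)" "\<omega> \<in> space M"
  shows "\<Phi> (X \<omega>) c = (\<Sum>a\<in>I. indicator {\<omega> \<in> space M. X \<omega> = a} \<omega> * \<Phi> a c)"
proof -
  have "X \<omega> \<in> I"
    using measurable_space[OF assms(2,3)] by simp
  moreover have "indicator {\<omega> \<in> space M. X \<omega> = a} \<omega> * \<Phi> a c = (if a = X \<omega> then \<Phi> a c else 0)" for a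
    using assms(3) by (auto simp: indicator_def)
  ultimately show ?thesis
    using assms(1) by simp
qed

context prob_space
begin

lemma expectation_finite_range:
  fixes \<phi> :: "'b \<Rightarrow> real"
  assumes "finite I" and X: "X \<in> measurable M (count_space I)"
  shows "integrable M (\<lambda>\<omega>. \<phi> (X \<omega>))" (is ?int)
    and "expectation (\<lambda>\<omega>. \<phi> (X \<omega>)) = (\<Sum>a\<in>I. prob {\<omega> \<in> space M. X \<omega> = a} * \<phi> a)" (is ?exp)
proof -
  have eq: "\<phi> (X \<omega>) = (\<Sum>a\<in>I. indicator {\<omega> \<in> space M. X \<omega> = a} \<omega> * \<phi> a)" if "\<omega> \<in> space M" for \<omega>
    using finite_range_indicator_sum[OF assms that, of "\<lambda>a _. \<phi> a"] by simp
  have int: "integrable M (\<lambda>\<omega>. indicator {\<omega> \<in> space M. X \<omega> = a} \<omega> * \<phi> a)" if "a \<in> I" for a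
    using measurable_count_space_level_set[OF X that]
    by (intro integrable_mult_left) (auto simp: emeasure_eq_measure)
  show ?int
    using int by (subst Bochner_Integration.integrable_cong[OF refl eq]) auto
  have "expectation (\<lambda>\<omega>. \<phi> (X \<omega>))
      = (\<Sum>a\<in>I. expectation (\<lambda>\<omega>. indicator {\<omega> \<in> space M. X \<omega> = a} \<omega> * \<phi> a))"
    using int by (subst Bochner_Integration.integral_cong[OF refl eq]) auto
  also have "\<dots> = (\<Sum>a\<in>I. prob {\<omega> \<in> space M. X \<omega> = a} * \<phi> a)"
    by (intro sum.cong refl) (auto intro!: arg_cong[where f = prob])
  finally show ?exp .
qed

lemma indep_vars_prob_pair:
  assumes "indep_vars (\<lambda>_. count_space I) X J" "j \<in> J" "l \<in> J" "j \<noteq> l" "a \<in> I" "b \<in> I"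
  shows "prob {\<omega> \<in> space M. X j \<omega> = a \<and> X l \<omega> = b}
       = prob {\<omega> \<in> space M. X j \<omega> = a} * prob {\<omega> \<in> space M. X l \<omega> = b}"
proof -
  define A where "A = (\<lambda>_. {a})(l := {b})"
  have "prob (\<Inter>i\<in>{j, l}. X i -` A i \<inter> space M) = (\<Prod>i\<in>{j, l}. prob (X i -` A i \<inter> space M))"
    using assms by (intro indep_varsD[OF assms(1)]) (auto simp: A_def)
  moreover have "(\<Inter>i\<in>{j, l}. X i -` A i \<inter> space M) = {\<omega> \<in> space M. X j \<omega> = a \<and> X l \<omega> = b}"
    "X j -` A j \<inter> space M = {\<omega> \<in> space M. X j \<omega> = a}"
    "X l -` A l \<inter> space M = {\<omega> \<in> space M. X l \<omega> = b}"
    using assms(4) by (auto simp: A_def)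
  ultimately show ?thesis
    using assms(4) by simp
qed

text \<open>Expanding the square, the term linear in the sum vanishes because \<open>w\<close> is
  centered, and the mixed inner products vanish by pairwise independence. What is left are
  \<open>card J\<close> equal diagonal terms.\<close>

lemma expectation_norm_sq_centered_sum:
  fixes w :: "'b \<Rightarrow> 'c::real_inner"
  assumes "finite I" "finite J" and indep: "indep_vars (\<lambda>_. count_space I) X J"
    and prob: "\<And>j a. j \<in> J \<Longrightarrow> a \<in> I \<Longrightarrow> prob {\<omega> \<in> space M. X j \<omega> = a} = p a"
    and centered: "(\<Sum>a\<in>I. p a *\<^sub>R w a) = 0"
  shows "integrable M (\<lambda>\<omega>. (norm (v + c *\<^sub>R (\<Sum>j\<in>J. w (X j \<omega>))))\<^sup>2)" (is ?int)
    and "expectation (\<lambda>\<omega>. (norm (v + c *\<^sub>R (\<Sum>j\<in>J. w (X j \<omega>))))\<^sup>2)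
           = (norm v)\<^sup>2 + c\<^sup>2 * real (card J) * (\<Sum>a\<in>I. p a * (norm (w a))\<^sup>2)" (is ?exp)
proof -
  have X: "X j \<in> measurable M (count_space I)" if "j \<in> J" for j
    using indep that by (auto simp: indep_vars_def)
  have single: "integrable M (\<lambda>\<omega>. \<phi> (X j \<omega>))"
    "expectation (\<lambda>\<omega>. \<phi> (X j \<omega>)) = (\<Sum>a\<in>I. p a * \<phi> a)" if "j \<in> J" for j and \<phi> :: "'b \<Rightarrow> real"
    using expectation_finite_range[OF \<open>finite I\<close> X[OF that], of \<phi>] prob[OF that] by simp_all
  have linear: "expectation (\<lambda>\<omega>. inner v (w (X j \<omega>))) = 0" if "j \<in> J" for j
  proof -
    have "(\<Sum>a\<in>I. p a * inner v (w a)) = inner v (\<Sum>a\<in>I. p a *\<^sub>R w a)"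
      by (simp add: inner_sum_right)
    then show ?thesis
      using single(2)[OF that, of "\<lambda>a. inner v (w a)"] centered by simp
  qed
  have pair: "integrable M (\<lambda>\<omega>. inner (w (X j \<omega>)) (w (X l \<omega>))) \<and>
      expectation (\<lambda>\<omega>. inner (w (X j \<omega>)) (w (X l \<omega>)))
        = (if j = l then \<Sum>a\<in>I. p a * (norm (w a))\<^sup>2 else 0)" if "j \<in> J" "l \<in> J" for j l
  proof (cases "j = l")
    case True
    then show ?thesis
      using single[OF \<open>j \<in> J\<close>, of "\<lambda>a. inner (w a) (w a)"] by (simp add: power2_norm_eq_inner)
  next
    case False
    have XY: "(\<lambda>\<omega>. (X j \<omega>, X l \<omega>)) \<in> measurable M (count_space (I \<times> I))"
    proof (subst measurable_count_space_eq2, use \<open>finite I\<close> in simp, intro conjI ballI)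
      show "(\<lambda>\<omega>. (X j \<omega>, X l \<omega>)) \<in> space M \<rightarrow> I \<times> I"
        using X[OF \<open>j \<in> J\<close>] X[OF \<open>l \<in> J\<close>] by (auto dest: measurable_space)
      fix c assume "c \<in> I \<times> I"
      then have "{\<omega> \<in> space M. X j \<omega> = fst c} \<inter> {\<omega> \<in> space M. X l \<omega> = snd c} \<in> sets M"
        using measurable_count_space_level_set[OF X] that by (intro sets.Int) auto
      moreover have "(\<lambda>\<omega>. (X j \<omega>, X l \<omega>)) -` {c} \<inter> space M
          = {\<omega> \<in> space M. X j \<omega> = fst c} \<inter> {\<omega> \<in> space M. X l \<omega> = snd c}"
        by auto
      ultimately show "(\<lambda>\<omega>. (X j \<omega>, X l \<omega>)) -` {c} \<inter> space M \<in> sets M" by simp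
    qed
    have "expectation (\<lambda>\<omega>. inner (w (X j \<omega>)) (w (X l \<omega>)))
        = (\<Sum>c\<in>I \<times> I. prob {\<omega> \<in> space M. (X j \<omega>, X l \<omega>) = c} * inner (w (fst c)) (w (snd c)))"
      using expectation_finite_range(2)[OF _ XY, of "\<lambda>c. inner (w (fst c)) (w (snd c))"] \<open>finite I\<close>
      by simp
    \<comment> \<open>Independence factors the joint probability, so the double sum becomes the
      inner product of the mean of \<open>w\<close> with itself, which is zero.\<close>
    also have "\<dots> = (\<Sum>c\<in>I \<times> I. inner (p (fst c) *\<^sub>R w (fst c)) (p (snd c) *\<^sub>R w (snd c)))"
      using indep_vars_prob_pair[OF indep that False] prob that by (intro sum.cong) auto
    also have "\<dots> = inner (\<Sum>a\<in>I. p a *\<^sub>R w a) (\<Sum>a\<in>I. p a *\<^sub>R w a)"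
      unfolding inner_sum_left inner_sum_right sum.cartesian_product
      by (simp add: case_prod_beta inner_commute ac_simps)
    finally show ?thesis
      using expectation_finite_range(1)[OF _ XY, of "\<lambda>c. inner (w (fst c)) (w (snd c))"]
        \<open>finite I\<close> False centered by simp
  qed
  have expand: "(norm (v + c *\<^sub>R (\<Sum>j\<in>J. w (X j \<omega>))))\<^sup>2
      = (norm v)\<^sup>2 + 2 * c * (\<Sum>j\<in>J. inner v (w (X j \<omega>)))
        + c\<^sup>2 * (\<Sum>j\<in>J. \<Sum>l\<in>J. inner (w (X j \<omega>)) (w (X l \<omega>)))" for \<omega>
  proof -
    have "(norm (v + c *\<^sub>R s))\<^sup>2 = (norm v)\<^sup>2 + 2 * c * inner v s + c\<^sup>2 * inner s s" for s
      unfolding power2_norm_eq_inner by (simp add: algebra_simps inner_commute power2_eq_square[of c])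
    moreover have "inner s s = (\<Sum>j\<in>J. \<Sum>l\<in>J. inner (w (X j \<omega>)) (w (X l \<omega>)))"
      if "s = (\<Sum>j\<in>J. w (X j \<omega>))" for s
      unfolding that by (simp add: inner_sum_left) (simp add: inner_sum_right)
    ultimately show ?thesis
      by (simp add: inner_sum_right)
  qed
  have int_linear: "integrable M (\<lambda>\<omega>. \<Sum>j\<in>J. inner v (w (X j \<omega>)))"
    by (intro Bochner_Integration.integrable_sum single(1))
  have int_square: "integrable M (\<lambda>\<omega>. \<Sum>j\<in>J. \<Sum>l\<in>J. inner (w (X j \<omega>)) (w (X l \<omega>)))"
    using pair by (intro Bochner_Integration.integrable_sum) blast
  show ?int
    unfolding expand using int_linear int_square by simp
  have "expectation (\<lambda>\<omega>. \<Sum>j\<in>J. inner v (w (X j \<omega>))) = 0"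
    using single(1) linear by (subst Bochner_Integration.integral_sum) auto
  moreover have "expectation (\<lambda>\<omega>. \<Sum>j\<in>J. \<Sum>l\<in>J. inner (w (X j \<omega>)) (w (X l \<omega>)))
      = (\<Sum>j\<in>J. \<Sum>l\<in>J. expectation (\<lambda>\<omega>. inner (w (X j \<omega>)) (w (X l \<omega>))))"
    using pair by (simp add: Bochner_Integration.integral_sum Bochner_Integration.integrable_sum)
  moreover have "\<dots> = real (card J) * (\<Sum>a\<in>I. p a * (norm (w a))\<^sup>2)"
  proof -
    have "(\<Sum>l\<in>J. expectation (\<lambda>\<omega>. inner (w (X j \<omega>)) (w (X l \<omega>)))) = (\<Sum>a\<in>I. p a * (norm (w a))\<^sup>2)"
      if "j \<in> J" for j
    proof -
      have "(\<Sum>l\<in>J. expectation (\<lambda>\<omega>. inner (w (X j \<omega>)) (w (X l \<omega>))))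
          = (\<Sum>l\<in>J. if j = l then \<Sum>a\<in>I. p a * (norm (w a))\<^sup>2 else 0)"
        using pair that by (intro sum.cong) auto
      then show ?thesis
        using \<open>finite J\<close> that by simp
    qed
    then show ?thesis by simp
  qed
  ultimately show ?exp
    unfolding expand using int_linear int_square by (simp add: prob_space)
qed

text \<open>Events of the real variables \<open>indicator E\<close> and
  \<open>g (Y \<omega>)\<close> are preimages under \<open>X\<close> and \<open>Y\<close>.
  Independence therefore passes to these two variables, and the product rule for expectations of
  real random variables applies.\<close>

lemma indep_rv_expectation_indicator_mult:
  fixes g :: "'c \<Rightarrow> real"
  assumes "indep_rv M N X N' Y" "A \<in> sets N" "g \<in> borel_measurable N'"
    and int: "integrable M (\<lambda>\<omega>. g (Y \<omega>))"
  defines "E \<equiv> X -` A \<inter> space M"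
  shows "integrable M (\<lambda>\<omega>. indicator E \<omega> * g (Y \<omega>))"
    and "expectation (\<lambda>\<omega>. indicator E \<omega> * g (Y \<omega>)) = prob E * expectation (\<lambda>\<omega>. g (Y \<omega>))"
proof -
  have X: "X \<in> measurable M N" and Y: "Y \<in> measurable M N'"
    and indep: "indep_set {X -` A \<inter> space M | A. A \<in> sets N} {Y -` A \<inter> space M | A. A \<in> sets N'}"
    using assms(1) by (auto simp: indep_rv_def)
  have E: "E \<in> sets M"
    unfolding E_def using X \<open>A \<in> sets N\<close> by (rule measurable_sets)
  \<comment> \<open>Stability under intersection extends independence from the families of preimages
    to the sigma-algebras they generate.\<close>
  have stable: "Int_stable {Z -` A \<inter> space M |A. A \<in> sets S}" for Z :: "'a \<Rightarrow> 'x" and S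
  proof (safe intro!: Int_stableI)
    fix A B assume "A \<in> sets S" "B \<in> sets S"
    then show "\<exists>C. (Z -` A \<inter> space M) \<inter> (Z -` B \<inter> space M) = (Z -` C \<inter> space M) \<and> C \<in> sets S"
      by (intro exI[of _ "A \<inter> B"]) auto
  qed
  have "indep_var borel (indicator E :: 'a \<Rightarrow> real) borel (\<lambda>\<omega>. g (Y \<omega>))"
    unfolding indep_var_eq
  proof (intro conjI indep_set_sigma_sets stable indep_setI)
    show gY: "random_variable borel (\<lambda>\<omega>. g (Y \<omega>))"
      using Y assms(3) by measurable
    show indE: "random_variable borel (indicator E :: 'a \<Rightarrow> real)"
      using E by measurable
    show "{indicator E -` A \<inter> space M |A. A \<in> sets (borel :: real measure)} \<subseteq> events"
      using measurable_sets[OF indE] by auto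
    show "{(\<lambda>\<omega>. g (Y \<omega>)) -` A \<inter> space M |A. A \<in> sets borel} \<subseteq> events"
      using measurable_sets[OF gY] by auto
    fix a b
    assume "a \<in> {indicator E -` A \<inter> space M |A. A \<in> sets (borel :: real measure)}"
      and "b \<in> {(\<lambda>\<omega>. g (Y \<omega>)) -` A \<inter> space M |A. A \<in> sets borel}"
    then obtain S :: "real set" and T where a: "a = indicator E -` S \<inter> space M"
      and b: "b = (\<lambda>\<omega>. g (Y \<omega>)) -` T \<inter> space M" and T: "T \<in> sets borel" by auto
    have "g -` T \<inter> space N' \<in> sets N'"
      using assms(3) T by (rule measurable_sets)
    moreover have "b = Y -` (g -` T \<inter> space N') \<inter> space M"
      using b measurable_space[OF Y] by auto
    \<comment> \<open>An indicator takes only the values \<open>0\<close> and \<open>1\<close>, so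
      membership of these two in \<open>S\<close> decides which set has \<open>a\<close> as its
      preimage under \<open>X\<close>.\<close>
    moreover define A' where "A' = (if 1 \<in> S then A else {}) \<union> (if 0 \<in> S then space N - A else {})"
    moreover have "a = X -` A' \<inter> space M"
      unfolding a A'_def E_def using measurable_space[OF X]
      by (auto simp: indicator_def of_bool_def split: if_splits)
    moreover have "A' \<in> sets N"
      using \<open>A \<in> sets N\<close> by (auto simp: A'_def)
    ultimately show "prob (a \<inter> b) = prob a * prob b"
      by (intro indep_setD[OF indep]) blast+
  qed
  moreover have "integrable M (indicator E :: 'a \<Rightarrow> real)"
    using E by (intro integrable_real_indicator) (simp_all add: emeasure_eq_measure)
  ultimately show "integrable M (\<lambda>\<omega>. indicator E \<omega> * g (Y \<omega>))"
    "expectation (\<lambda>\<omega>. indicator E \<omega> * g (Y \<omega>)) = prob E * expectation (\<lambda>\<omega>. g (Y \<omega>))"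
    using indep_var_integrable[of "indicator E" "\<lambda>\<omega>. g (Y \<omega>)"]
      indep_var_lebesgue_integral[of "indicator E" "\<lambda>\<omega>. g (Y \<omega>)"] int E
    by (auto simp: E_def)
qed

text \<open>For finitely many values of \<open>X\<close> this replaces conditioning on \<open>Y\<close>.\<close>
lemma indep_rv_expectation_le:
  fixes \<Phi> :: "'b \<Rightarrow> 'c \<Rightarrow> real"
  assumes "finite I" and indep: "indep_rv M (count_space I) X N' Y"
    and meas: "\<And>i. i \<in> I \<Longrightarrow> \<Phi> i \<in> borel_measurable N'"
    and int: "\<And>i. i \<in> I \<Longrightarrow> integrable M (\<lambda>\<omega>. \<Phi> i (Y \<omega>))"
    and bound: "\<And>y. y \<in> space N' \<Longrightarrow> expectation (\<lambda>\<omega>. \<Phi> (X \<omega>) y) \<le> C y"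
    and C: "integrable M (\<lambda>\<omega>. C (Y \<omega>))"
  shows "integrable M (\<lambda>\<omega>. \<Phi> (X \<omega>) (Y \<omega>))" (is ?int)
    and "expectation (\<lambda>\<omega>. \<Phi> (X \<omega>) (Y \<omega>)) \<le> expectation (\<lambda>\<omega>. C (Y \<omega>))" (is ?le)
proof -
  define E where "E i = {\<omega> \<in> space M. X \<omega> = i}" for i
  have E_eq: "E i = X -` {i} \<inter> space M" for i
    by (auto simp: E_def)
  have X: "X \<in> measurable M (count_space I)"
    using indep by (simp add: indep_rv_def)
  have Y: "Y \<in> measurable M N'"
    using indep by (simp add: indep_rv_def)
  have eq: "\<Phi> (X \<omega>) (Y \<omega>) = (\<Sum>i\<in>I. indicator (E i) \<omega> * \<Phi> i (Y \<omega>))" if "\<omega> \<in> space M" for \<omega>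
    unfolding E_def using finite_range_indicator_sum[OF \<open>finite I\<close> X that] .
  have summand: "integrable M (\<lambda>\<omega>. indicator (E i) \<omega> * \<Phi> i (Y \<omega>))"
    "expectation (\<lambda>\<omega>. indicator (E i) \<omega> * \<Phi> i (Y \<omega>)) = prob (E i) * expectation (\<lambda>\<omega>. \<Phi> i (Y \<omega>))"
    if "i \<in> I" for i
    using indep_rv_expectation_indicator_mult[OF indep _ meas[OF that] int[OF that], of "{i}"] that
    by (auto simp: E_eq)
  show ?int
    using summand(1) by (subst Bochner_Integration.integrable_cong[OF refl eq]) auto
  have "expectation (\<lambda>\<omega>. \<Phi> (X \<omega>) (Y \<omega>)) = (\<Sum>i\<in>I. prob (E i) * expectation (\<lambda>\<omega>. \<Phi> i (Y \<omega>)))"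
    using summand by (subst Bochner_Integration.integral_cong[OF refl eq]) auto
  \<comment> \<open>The probabilities are now constant weights. At each \<open>\<omega>\<close> the
    sum is the expectation over \<open>X\<close> with the second argument frozen at
    \<open>y = Y \<omega>\<close>, so \<open>bound\<close> applies pointwise.\<close>
  also have "\<dots> = expectation (\<lambda>\<omega>. \<Sum>i\<in>I. prob (E i) * \<Phi> i (Y \<omega>))"
    using int by simp
  also have "\<dots> \<le> expectation (\<lambda>\<omega>. C (Y \<omega>))"
  proof (rule integral_mono)
    show "integrable M (\<lambda>\<omega>. \<Sum>i\<in>I. prob (E i) * \<Phi> i (Y \<omega>))"
      using int by auto
    fix \<omega> assume "\<omega> \<in> space M"
    then show "(\<Sum>i\<in>I. prob (E i) * \<Phi> i (Y \<omega>)) \<le> C (Y \<omega>)"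
      using bound[of "Y \<omega>"] measurable_space[OF Y] expectation_finite_range(2)[OF \<open>finite I\<close> X, of "\<lambda>i. \<Phi> i (Y \<omega>)"]
      by (simp add: E_def)
  qed (rule C)
  finally show ?le .
qed

end

text \<open>A Lipschitz map grows at most linearly, so square integrability passes through it. This
  carries integrability from one iterate to the next.\<close>

lemma integrable_lipschitz_norm_sq:
  fixes T :: "'a::euclidean_space \<Rightarrow> 'b::euclidean_space" and Y :: "'w \<Rightarrow> 'a"
  assumes "finite_measure M" and Y: "Y \<in> borel_measurable M" and T: "C-lipschitz_on UNIV T"
    and int: "integrable M (\<lambda>\<omega>. (norm (Y \<omega> - c))\<^sup>2)"
  shows "integrable M (\<lambda>\<omega>. (norm (T (Y \<omega>)))\<^sup>2)"
proof (rule Bochner_Integration.integrable_bound)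
  interpret finite_measure M by fact
  show "integrable M (\<lambda>\<omega>. 2 * (norm (T c))\<^sup>2 + 2 * (C\<^sup>2 * (norm (Y \<omega> - c))\<^sup>2))"
    using int by auto
  have "T \<in> borel_measurable borel"
    using lipschitz_on_continuous_on[OF T] by (rule borel_measurable_continuous_onI)
  then show "(\<lambda>\<omega>. (norm (T (Y \<omega>)))\<^sup>2) \<in> borel_measurable M"
    using Y by measurable
  have "(norm (T y))\<^sup>2 \<le> 2 * (norm (T c))\<^sup>2 + 2 * (C\<^sup>2 * (norm (y - c))\<^sup>2)" for y
  proof -
    have "norm (T y - T c) \<le> C * norm (y - c)"
      using lipschitz_onD[OF T, of y c] by (simp add: dist_norm)
    then have "(norm (T y - T c))\<^sup>2 \<le> (C * norm (y - c))\<^sup>2"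
      by (rule power_mono) simp
    then show ?thesis
      using norm_add_sq_le[of "T c" "T y - T c"] by (simp add: power_mult_distrib)
  qed
  then show "AE \<omega> in M. norm ((norm (T (Y \<omega>)))\<^sup>2) \<le> norm (2 * (norm (T c))\<^sup>2 + 2 * (C\<^sup>2 * (norm (Y \<omega> - c))\<^sup>2))"
    by (auto intro!: AE_I2 order_trans[OF _ abs_ge_self])
qed

section \<open>Mini-batch gradients\<close>

lemma GDERIV_scaled_sum:
  assumes "finite I" "\<And>i. i \<in> I \<Longrightarrow> GDERIV (f i) y :> D i"
  shows "GDERIV (\<lambda>y. c * (\<Sum>i\<in>I. f i y)) y :> c *\<^sub>R (\<Sum>i\<in>I. D i)"
  using assms unfolding gderiv_def
  by (auto intro!: derivative_eq_intros simp: inner_sum_right)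

lemma lipschitz_on_sum_ex:
  fixes f :: "'b \<Rightarrow> 'a::metric_space \<Rightarrow> 'c::real_normed_vector"
  assumes "finite A" "\<And>a. a \<in> A \<Longrightarrow> \<exists>C. C-lipschitz_on U (f a)"
  shows "\<exists>C. C-lipschitz_on U (\<lambda>x. \<Sum>a\<in>A. f a x)"
  using assms
proof (induction A rule: finite_induct)
  case empty
  show ?case using lipschitz_on_constant by auto
next
  case (insert a A)
  then show ?case
    by (simp, metis lipschitz_on_add)
qed

lemma smooth_fun_lipschitz: "smooth_fun L g \<Longrightarrow> L-lipschitz_on UNIV (grad g)"
  by (auto simp: smooth_fun_def lipschitz_on_def dist_norm)

text \<open>Independence from the past is stated for the batch as a restricted function, a point of
  the product space; this connects it with the recursion.\<close>

lemma minibatch_gradient_restrict: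
  "minibatch_gradient n B p f (\<lambda>j\<in>{1..B}. i j) y = minibatch_gradient n B p f i y"
  by (simp add: minibatch_gradient_def)

text \<open>For a fixed batch \<open>i\<close>, the update is Lipschitz in the iterate. The
  existence of some constant is enough for measurability and square integrability.\<close>

lemma minibatch_update_lipschitz:
  assumes f: "\<And>i. i \<in> {1..n} \<Longrightarrow> smooth_fun (L i) (f i)" and h: "smooth_fun L\<^sub>h h"
    and i: "\<And>j. j \<in> {1..B} \<Longrightarrow> i j \<in> {1..n}"
  shows "\<exists>C. C-lipschitz_on UNIV (\<lambda>y. y - \<eta> *\<^sub>R (minibatch_gradient n B p f i y + grad h y) - c)"
proof -
  have "\<exists>C. C-lipschitz_on UNIV (\<lambda>y. \<Sum>j=1..B. (1 / (real n * p (i j))) *\<^sub>R grad (f (i j)) y)"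
    using lipschitz_on_cmult[OF smooth_fun_lipschitz[OF f[OF i]]]
    by (intro lipschitz_on_sum_ex) blast+
  then obtain C where "C-lipschitz_on UNIV (\<lambda>y. \<Sum>j=1..B. (1 / (real n * p (i j))) *\<^sub>R grad (f (i j)) y)"
    by blast
  then show ?thesis
    unfolding minibatch_gradient_def
    using lipschitz_on_diff[OF lipschitz_on_diff[OF lipschitz_on_id lipschitz_on_cmult[OF
            lipschitz_on_add[OF lipschitz_on_cmult smooth_fun_lipschitz[OF h]]]] lipschitz_on_constant]
    by blast
qed

text \<open>Unbiasedness of importance sampling: the weight \<open>1 / (n * p i)\<close> cancels the
  probability of drawing \<open>i\<close>.\<close>

lemma importance_weighted_sum:
  fixes g :: "nat \<Rightarrow> 'a::real_vector"
  assumes "\<And>i. i \<in> {1..n} \<Longrightarrow> p i > 0"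
  shows "(\<Sum>i=1..n. p i *\<^sub>R ((1 / (real n * p i)) *\<^sub>R g i)) = (1 / real n) *\<^sub>R (\<Sum>i=1..n. g i)"
  unfolding scaleR_sum_right
proof (intro sum.cong refl)
  fix i assume "i \<in> {1..n}"
  then have "p i \<noteq> 0" using assms by force
  then show "p i *\<^sub>R ((1 / (real n * p i)) *\<^sub>R g i) = (1 / real n) *\<^sub>R g i" by simp
qed

text \<open>The expected squared distance of the mini-batch gradient at \<open>y\<close> from its
  mean, written in the shape of \<open>\<sigma>\<^sub>F\<close>, which is its value at
  \<open>x_star\<close>.\<close>

definition minibatch_variance ::
    "nat \<Rightarrow> nat \<Rightarrow> (nat \<Rightarrow> real) \<Rightarrow> (nat \<Rightarrow> 'a::euclidean_space \<Rightarrow> real) \<Rightarrow> 'a \<Rightarrow> real" where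
  "minibatch_variance n B p f y =
     1 / real B * (1 / real n * (\<Sum>i=1..n. 1 / (real n * p i) * (norm (grad (f i) y))\<^sup>2)
       - (norm ((1 / real n) *\<^sub>R (\<Sum>i=1..n. grad (f i) y)))\<^sup>2)"

text \<open>The subtracted vector is the mean of the weighted gradients under \<open>p\<close>, so
  the variance identity applies. This form shows nonnegativity.\<close>

lemma minibatch_variance_eq:
  fixes f :: "nat \<Rightarrow> 'a::euclidean_space \<Rightarrow> real"
  assumes p: "\<And>i. i \<in> {1..n} \<Longrightarrow> p i > 0" "(\<Sum>i=1..n. p i) = 1"
  shows "minibatch_variance n B p f y = 1 / real B * (\<Sum>i=1..n. p i *
           (norm ((1 / (real n * p i)) *\<^sub>R grad (f i) y - (1 / real n) *\<^sub>R (\<Sum>i=1..n. grad (f i) y)))\<^sup>2)"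
proof -
  let ?u = "\<lambda>i. (1 / (real n * p i)) *\<^sub>R grad (f i) y"
  have "(1 / real n) *\<^sub>R (\<Sum>i=1..n. grad (f i) y) = (\<Sum>i=1..n. p i *\<^sub>R ?u i)"
    using p(1) by (rule importance_weighted_sum[symmetric])
  moreover have "1 / real n * (\<Sum>i=1..n. 1 / (real n * p i) * (norm (grad (f i) y))\<^sup>2)
      = (\<Sum>i=1..n. p i * (norm (?u i))\<^sup>2)"
    unfolding sum_distrib_left
  proof (intro sum.cong refl)
    fix i assume "i \<in> {1..n}"
    then have "p i > 0" by (rule p(1))
    then show "1 / real n * (1 / (real n * p i) * (norm (grad (f i) y))\<^sup>2) = p i * (norm (?u i))\<^sup>2"
      by (simp add: power2_eq_square field_simps)
  qed
  ultimately show ?thesis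
    unfolding minibatch_variance_def
    using sum_weighted_centered_norm_sq[OF p(2), of _ ?u] by simp
qed

lemma minibatch_variance_nonneg:
  assumes "\<And>i. i \<in> {1..n} \<Longrightarrow> p i > 0" "(\<Sum>i=1..n. p i) = 1"
  shows "0 \<le> minibatch_variance n B p f y"
  using assms(1) by (subst minibatch_variance_eq[of n p, OF assms])
    (auto intro!: mult_nonneg_nonneg sum_nonneg divide_nonneg_nonneg intro: less_imp_le)

text \<open>The deviation at \<open>y\<close> is the deviation at \<open>z\<close> plus the change
  between the two points, and the square of the sum costs a factor 2. The change is itself centered
  under \<open>p\<close>, so its mean may be dropped before the Lipschitz bounds are used.\<close>

lemma minibatch_variance_le:
  fixes f :: "nat \<Rightarrow> 'a::euclidean_space \<Rightarrow> real"
  assumes p: "\<And>i. i \<in> {1..n} \<Longrightarrow> p i > 0" "(\<Sum>i=1..n. p i) = 1"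
    and f: "\<And>i. i \<in> {1..n} \<Longrightarrow> smooth_fun (L i) (f i)"
  shows "minibatch_variance n B p f y \<le> 2 * minibatch_variance n B p f z
           + 2 / (real B * real n) * (\<Sum>i=1..n. (L i)\<^sup>2 / (real n * p i)) * (norm (y - z))\<^sup>2"
proof -
  define u where "u i y = (1 / (real n * p i)) *\<^sub>R grad (f i) y" for i y
  define m where "m y = (1 / real n) *\<^sub>R (\<Sum>i=1..n. grad (f i) y)" for y
  have variance_eq: "minibatch_variance n B p f y = 1 / real B * (\<Sum>i=1..n. p i * (norm (u i y - m y))\<^sup>2)" for y
    unfolding u_def m_def using p by (rule minibatch_variance_eq)
  have m: "m y - m z = (\<Sum>i=1..n. p i *\<^sub>R (u i y - u i z))"
  proof -
    have "m y - m z = (1 / real n) *\<^sub>R (\<Sum>i=1..n. grad (f i) y - grad (f i) z)"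
      by (simp add: m_def sum_subtractf scaleR_diff_right)
    also have "\<dots> = (\<Sum>i=1..n. p i *\<^sub>R (u i y - u i z))"
      unfolding u_def scaleR_diff_right[symmetric] using p(1) by (rule importance_weighted_sum[symmetric])
    finally show ?thesis .
  qed
  have "(\<Sum>i=1..n. p i * (norm (u i y - m y))\<^sup>2)
      \<le> (\<Sum>i=1..n. p i * (2 * (norm (u i z - m z))\<^sup>2 + 2 * (norm ((u i y - u i z) - (m y - m z)))\<^sup>2))"
  proof (intro sum_mono mult_left_mono)
    fix i assume "i \<in> {1..n}"
    show "(norm (u i y - m y))\<^sup>2 \<le> 2 * (norm (u i z - m z))\<^sup>2 + 2 * (norm ((u i y - u i z) - (m y - m z)))\<^sup>2"
      using norm_add_sq_le[of "u i z - m z" "(u i y - u i z) - (m y - m z)"] by simp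
  qed (use p(1) in \<open>auto intro: less_imp_le\<close>)
  also have "\<dots> = 2 * (\<Sum>i=1..n. p i * (norm (u i z - m z))\<^sup>2)
      + 2 * (\<Sum>i=1..n. p i * (norm ((u i y - u i z) - (m y - m z)))\<^sup>2)"
    by (simp add: distrib_left sum.distrib sum_distrib_left mult.left_commute)
  also have "(\<Sum>i=1..n. p i * (norm ((u i y - u i z) - (m y - m z)))\<^sup>2)
      \<le> (\<Sum>i=1..n. p i * (norm (u i y - u i z))\<^sup>2)"
    unfolding sum_weighted_centered_norm_sq[OF p(2) m] by simp
  also have "\<dots> \<le> (\<Sum>i=1..n. 1 / real n * ((L i)\<^sup>2 / (real n * p i)) * (norm (y - z))\<^sup>2)"
  proof (intro sum_mono)
    fix i assume i: "i \<in> {1..n}"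
    then have "p i > 0" by (rule p(1))
    have "norm (grad (f i) y - grad (f i) z) \<le> L i * norm (y - z)"
      using f[OF i] by (simp add: smooth_fun_def)
    then have *: "(norm (grad (f i) y - grad (f i) z))\<^sup>2 \<le> (L i)\<^sup>2 * (norm (y - z))\<^sup>2"
      by (metis norm_ge_zero power_mono power_mult_distrib)
    have "p i * (norm (u i y - u i z))\<^sup>2 = 1 / (real n * real n * p i) * (norm (grad (f i) y - grad (f i) z))\<^sup>2"
      using \<open>p i > 0\<close> unfolding u_def scaleR_diff_right[symmetric]
      by (simp add: power_mult_distrib power2_eq_square)
    also have "\<dots> \<le> 1 / (real n * real n * p i) * ((L i)\<^sup>2 * (norm (y - z))\<^sup>2)"
      using * \<open>p i > 0\<close> by (intro mult_left_mono) auto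
    finally show "p i * (norm (u i y - u i z))\<^sup>2 \<le> 1 / real n * ((L i)\<^sup>2 / (real n * p i)) * (norm (y - z))\<^sup>2"
      by simp
  qed
  also have "\<dots> = 1 / real n * (\<Sum>i=1..n. (L i)\<^sup>2 / (real n * p i)) * (norm (y - z))\<^sup>2"
    by (simp add: sum_distrib_left sum_distrib_right)
  finally have "(\<Sum>i=1..n. p i * (norm (u i y - m y))\<^sup>2)
      \<le> 2 * (\<Sum>i=1..n. p i * (norm (u i z - m z))\<^sup>2)
        + 2 * (1 / real n * (\<Sum>i=1..n. (L i)\<^sup>2 / (real n * p i)) * (norm (y - z))\<^sup>2)"
    by simp
  then have "1 / real B * (\<Sum>i=1..n. p i * (norm (u i y - m y))\<^sup>2)
      \<le> 1 / real B * (2 * (\<Sum>i=1..n. p i * (norm (u i z - m z))\<^sup>2)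
        + 2 * (1 / real n * (\<Sum>i=1..n. (L i)\<^sup>2 / (real n * p i)) * (norm (y - z))\<^sup>2))"
    by (rule mult_left_mono) simp
  then show ?thesis
    unfolding variance_eq by (simp add: distrib_left mult.assoc)
qed

text \<open>The step is the exact one plus \<open>- \<eta> / B\<close> times a sum of
  \<open>B\<close> independent centered terms, whose second moments add up;
  \<open>B / B\<^sup>2\<close> gives the factor \<open>1 / B\<close> of the variance.\<close>

lemma (in prob_space) expectation_minibatch_step:
  fixes f :: "nat \<Rightarrow> 'b::euclidean_space \<Rightarrow> real"
  assumes "B \<ge> 1" and p: "\<And>i. i \<in> {1..n} \<Longrightarrow> p i > 0" "(\<Sum>i=1..n. p i) = 1"
    and indep: "indep_vars (\<lambda>_. count_space {1..n}) X {1..B}"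
    and prob: "\<And>j i. j \<in> {1..B} \<Longrightarrow> i \<in> {1..n} \<Longrightarrow> prob {\<omega> \<in> space M. X j \<omega> = i} = p i"
  shows "expectation (\<lambda>\<omega>. (norm (v - \<eta> *\<^sub>R minibatch_gradient n B p f (\<lambda>j. X j \<omega>) y))\<^sup>2)
           = (norm (v - \<eta> *\<^sub>R ((1 / real n) *\<^sub>R (\<Sum>i=1..n. grad (f i) y))))\<^sup>2
             + \<eta>\<^sup>2 * minibatch_variance n B p f y"
proof -
  define m where "m = (1 / real n) *\<^sub>R (\<Sum>i=1..n. grad (f i) y)"
  define w where "w i = (1 / (real n * p i)) *\<^sub>R grad (f i) y - m" for i
  have "(\<Sum>i=1..n. p i *\<^sub>R ((1 / (real n * p i)) *\<^sub>R grad (f i) y)) = m"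
    unfolding m_def using p(1) by (rule importance_weighted_sum)
  then have centered: "(\<Sum>i=1..n. p i *\<^sub>R w i) = 0"
    using p(2) by (simp add: w_def scaleR_diff_right sum_subtractf flip: scaleR_sum_left)
  have variance: "minibatch_variance n B p f y = 1 / real B * (\<Sum>i=1..n. p i * (norm (w i))\<^sup>2)"
    unfolding w_def m_def using p by (rule minibatch_variance_eq)
  have "v - \<eta> *\<^sub>R minibatch_gradient n B p f i y = (v - \<eta> *\<^sub>R m) + (- \<eta> / real B) *\<^sub>R (\<Sum>j=1..B. w (i j))" for i
    using \<open>B \<ge> 1\<close>
    by (simp add: minibatch_gradient_def w_def sum_subtractf scaleR_diff_right sum_constant_scaleR)
  then have step_eq: "(\<lambda>\<omega>. (norm (v - \<eta> *\<^sub>R minibatch_gradient n B p f (\<lambda>j. X j \<omega>) y))\<^sup>2)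
      = (\<lambda>\<omega>. (norm ((v - \<eta> *\<^sub>R m) + (- \<eta> / real B) *\<^sub>R (\<Sum>j=1..B. w (X j \<omega>))))\<^sup>2)"
    by (simp only:)
  have "expectation (\<lambda>\<omega>. (norm (v - \<eta> *\<^sub>R minibatch_gradient n B p f (\<lambda>j. X j \<omega>) y))\<^sup>2)
      = (norm (v - \<eta> *\<^sub>R m))\<^sup>2
        + (- \<eta> / real B)\<^sup>2 * real (card {1..B}) * (\<Sum>i=1..n. p i * (norm (w i))\<^sup>2)"
    unfolding step_eq
    by (intro expectation_norm_sq_centered_sum(2)[OF _ _ indep prob centered]) simp_all
  also have "(- \<eta> / real B)\<^sup>2 * real (card {1..B}) = \<eta>\<^sup>2 * (1 / real B)"
    using \<open>B \<ge> 1\<close> by (simp add: power2_eq_square)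
  finally show ?thesis
    unfolding variance m_def[symmetric] by (simp only: mult.assoc)
qed

section \<open>Contraction of the expected squared error\<close>

text \<open>Expand the square, bound the extra term by
  \<open>\<eta>\<^sup>2 * s * (norm G)\<^sup>2\<close> through \<open>expansive\<close>, and bound
  the inner product through \<open>inner\<close>. The total coefficient of
  \<open>(norm G)\<^sup>2\<close> is then
  \<open>\<eta>\<^sup>2 * (s + 1) - 2 * \<eta> / (L + lam)\<close>, which the step size makes
  nonpositive.\<close>

lemma gradient_step_contraction:
  fixes v G :: "'a::real_inner"
  assumes pos: "0 < lam" "0 < L" "0 \<le> s" "0 < \<eta>"
    and step: "\<eta> \<le> 2 / ((s + 1) * (L + lam))"
    and inner: "(norm G)\<^sup>2 + lam * L * (norm v)\<^sup>2 \<le> (L + lam) * inner G v"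
    and expansive: "lam * norm v \<le> norm G"
  shows "(norm (v - \<eta> *\<^sub>R G))\<^sup>2 + \<eta>\<^sup>2 * (s * lam\<^sup>2 * (norm v)\<^sup>2)
           \<le> (1 - 2 * \<eta> * lam * L / (L + lam)) * (norm v)\<^sup>2"
proof -
  have "0 < L + lam" using pos by simp
  have "(norm (v - \<eta> *\<^sub>R G))\<^sup>2 = (norm v)\<^sup>2 - 2 * \<eta> * inner G v + \<eta>\<^sup>2 * (norm G)\<^sup>2"
    unfolding power2_norm_eq_inner by (simp add: algebra_simps inner_commute power2_eq_square[of \<eta>])
  moreover have "\<eta> * (s * lam\<^sup>2 * (norm v)\<^sup>2) \<le> \<eta> * (s * (norm G)\<^sup>2)"
  proof -
    have "(lam * norm v)\<^sup>2 \<le> (norm G)\<^sup>2"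
      using expansive pos by (intro power_mono) auto
    then show ?thesis
      using pos by (simp add: power_mult_distrib mult_left_mono)
  qed
  then have "\<eta>\<^sup>2 * (s * lam\<^sup>2 * (norm v)\<^sup>2) \<le> \<eta>\<^sup>2 * (s * (norm G)\<^sup>2)"
    using pos by simp
  moreover have "2 * \<eta> * ((norm G)\<^sup>2 + lam * L * (norm v)\<^sup>2) / (L + lam) \<le> 2 * \<eta> * inner G v"
    using mult_left_mono[OF inner, of "2 * \<eta>"] pos by (simp add: field_simps)
  moreover have "\<eta>\<^sup>2 * (s + 1) * (norm G)\<^sup>2 \<le> 2 * \<eta> / (L + lam) * (norm G)\<^sup>2"
  proof (intro mult_right_mono)
    have "\<eta> * (s + 1) * (L + lam) \<le> 2"
      using step pos by (simp add: pos_le_divide_eq mult.assoc)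
    then have "\<eta> * (s + 1) \<le> 2 / (L + lam)"
      using \<open>0 < L + lam\<close> by (simp add: pos_le_divide_eq)
    then have "\<eta> * (\<eta> * (s + 1)) \<le> \<eta> * (2 / (L + lam))"
      using pos by (intro mult_left_mono) auto
    then show "\<eta>\<^sup>2 * (s + 1) \<le> 2 * \<eta> / (L + lam)"
      by (simp add: power2_eq_square mult.assoc mult.commute mult.left_commute)
  qed simp
  moreover have "2 * \<eta> * ((norm G)\<^sup>2 + lam * L * (norm v)\<^sup>2) / (L + lam)
      = 2 * \<eta> / (L + lam) * (norm G)\<^sup>2 + 2 * \<eta> * lam * L / (L + lam) * (norm v)\<^sup>2"
    by (simp add: distrib_left add_divide_distrib)
  ultimately show ?thesis
    by (simp add: algebra_simps)
qed

text \<open>Conditionally on \<open>x k\<close> the error splits into that of an exact gradient step on \<open>\<psi>\<close> and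
  the variance of the mini-batch gradient; the part of the variance that grows with
  \<open>norm (x k - x_star)\<close> is absorbed by the gain of the gradient step.\<close>
lemma minibatch_sgd_step:
  fixes f :: "nat \<Rightarrow> 'a::euclidean_space \<Rightarrow> real" and \<eta> :: real
  assumes "n \<ge> 1" "B \<ge> 1" and k: "k \<in> {1..K}"
    and f: "\<And>i. i \<in> {1..n} \<Longrightarrow> smooth_fun (L i) (f i)" and h: "smooth_fun L\<^sub>h h"
    and sc: "strongly_convex lam (\<lambda>y. (1 / real n) * (\<Sum>i=1..n. f i y) + h y)" (is "strongly_convex lam ?\<psi>")
    and min: "is_arg_min (\<lambda>y. (1 / real n) * (\<Sum>i=1..n. f i y) + h y) (\<lambda>_. True) x_star"
    and p: "\<And>i. i \<in> {1..n} \<Longrightarrow> p i > 0" "(\<Sum>i=1..n. p i) = 1"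
    and sgd: "minibatch_sgd M n B K p \<eta> f h x\<^sub>1 \<xi> x"
    and "0 < \<eta>" and step: "\<eta> \<le> 2 / ((s + 1) * (1 / real n * (\<Sum>i=1..n. L i) + L\<^sub>h + lam))"
    and s: "s = 2 / (real B * lam\<^sup>2 * real n) * (\<Sum>i=1..n. (L i)\<^sup>2 / (real n * p i))"
    and q: "q = 2 * \<eta> * lam * (1 / real n * (\<Sum>i=1..n. L i) + L\<^sub>h)
                 / (1 / real n * (\<Sum>i=1..n. L i) + L\<^sub>h + lam)"
    and int: "integrable M (\<lambda>\<omega>. (norm (x k \<omega> - x_star))\<^sup>2)"
  shows "integrable M (\<lambda>\<omega>. (norm (x (k + 1) \<omega> - x_star))\<^sup>2)"
    and "(LINT \<omega>|M. (norm (x (k + 1) \<omega> - x_star))\<^sup>2)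
           \<le> (1 - q) * (LINT \<omega>|M. (norm (x k \<omega> - x_star))\<^sup>2)
             + 2 * \<eta>\<^sup>2 * minibatch_variance n B p f x_star"
proof -
  interpret prob_space M
    using sgd by (simp add: minibatch_sgd_def)
  define Lt where "Lt = 1 / real n * (\<Sum>i=1..n. L i) + L\<^sub>h"
  define m where "m y = (1 / real n) *\<^sub>R (\<Sum>i=1..n. grad (f i) y)" for y
  have "lam > 0" using sc by (simp add: strongly_convex_def)
  have L: "L i > 0" if "i \<in> {1..n}" for i using f[OF that] by (simp add: smooth_fun_def)
  have "L\<^sub>h > 0" using h by (simp add: smooth_fun_def)
  moreover have "(\<Sum>i=1..n. L i) \<ge> 0"
    using L by (intro sum_nonneg less_imp_le)
  ultimately have "Lt > 0"
    unfolding Lt_def by (intro add_nonneg_pos) auto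
  have "s \<ge> 0"
    unfolding s using p(1)
    by (intro mult_nonneg_nonneg sum_nonneg divide_nonneg_nonneg) (auto intro: less_imp_le)
  have grad: "grad ?\<psi> y = m y + grad h y" for y
    unfolding m_def
    by (intro grad_eqI GDERIV_add GDERIV_scaled_sum finite_atLeastAtMost smooth_fun_GDERIV[OF f] smooth_fun_GDERIV[OF h])
  have lip: "norm (grad ?\<psi> y - grad ?\<psi> z) \<le> Lt * norm (y - z)" for y z
  proof -
    have "norm (m y - m z) = 1 / real n * norm (\<Sum>i=1..n. grad (f i) y - grad (f i) z)"
      by (simp add: m_def sum_subtractf flip: scaleR_diff_right)
    also have "\<dots> \<le> 1 / real n * (\<Sum>i=1..n. L i * norm (y - z))"
      using f by (intro mult_left_mono sum_norm_le) (auto simp: smooth_fun_def)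
    finally have "norm (m y - m z) \<le> 1 / real n * (\<Sum>i=1..n. L i) * norm (y - z)"
      by (simp add: sum_distrib_right)
    moreover have "norm (grad h y - grad h z) \<le> L\<^sub>h * norm (y - z)"
      using h by (simp add: smooth_fun_def)
    moreover have "norm (grad ?\<psi> y - grad ?\<psi> z) \<le> norm (m y - m z) + norm (grad h y - grad h z)"
      unfolding grad by (rule norm_diff_triangle_ineq[THEN order_trans]) simp
    ultimately show ?thesis
      by (simp add: Lt_def distrib_right)
  qed
  have grad_star: "grad ?\<psi> x_star = 0"
    using sc min by (intro grad_eq_0_at_minimum) (auto simp: strongly_convex_def cont_diff_def)
  define \<sigma> where "\<sigma> = minibatch_variance n B p f x_star"

  \<comment> \<open>\<open>T i y\<close> is the error after one step from the point \<open>y\<close>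
    with the batch \<open>i\<close>, both deterministic.\<close>
  define T where "T i y = y - \<eta> *\<^sub>R (minibatch_gradient n B p f i y + grad h y) - x_star" for i y
  have \<xi>: "indep_vars (\<lambda>_. count_space {1..n}) (\<xi> k) {1..B}"
    "\<And>j i. j \<in> {1..B} \<Longrightarrow> i \<in> {1..n} \<Longrightarrow> prob {\<omega> \<in> space M. \<xi> k j \<omega> = i} = p i"
    and indep: "indep_rv M (PiM {1..B} (\<lambda>_. count_space {1..n})) (\<lambda>\<omega>. \<lambda>j\<in>{1..B}. \<xi> k j \<omega>)
          (PiM {1..k} (\<lambda>_. borel)) (\<lambda>\<omega>. \<lambda>l\<in>{1..k}. x l \<omega>)"
    and rec: "\<And>\<omega>. \<omega> \<in> space M \<Longrightarrow> x (k + 1) \<omega> - x_star = T (\<lambda>j. \<xi> k j \<omega>) (x k \<omega>)"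
    using sgd k by (auto simp: minibatch_sgd_def T_def)
  have T_bound: "expectation (\<lambda>\<omega>. (norm (T (\<lambda>j. \<xi> k j \<omega>) y))\<^sup>2)
      \<le> (1 - q) * (norm (y - x_star))\<^sup>2 + 2 * \<eta>\<^sup>2 * \<sigma>" for y
  proof -
    have T_eq: "T i y = (y - x_star - \<eta> *\<^sub>R grad h y) - \<eta> *\<^sub>R minibatch_gradient n B p f i y" for i
      by (simp add: T_def algebra_simps)
    have "expectation (\<lambda>\<omega>. (norm (T (\<lambda>j. \<xi> k j \<omega>) y))\<^sup>2)
        = (norm ((y - x_star - \<eta> *\<^sub>R grad h y) - \<eta> *\<^sub>R m y))\<^sup>2 + \<eta>\<^sup>2 * minibatch_variance n B p f y"
      unfolding T_eq m_def using \<open>B \<ge> 1\<close> p \<xi> by (rule expectation_minibatch_step)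
    also have "(y - x_star - \<eta> *\<^sub>R grad h y) - \<eta> *\<^sub>R m y = (y - x_star) - \<eta> *\<^sub>R grad ?\<psi> y"
      unfolding grad by (simp add: algebra_simps)
    \<comment> \<open>The bound is substituted below the factor \<open>\<eta>\<^sup>2\<close>; the
      resulting monotonicity condition is discharged at the end of the chain.\<close>
    also have "minibatch_variance n B p f y \<le> 2 * \<sigma> + s * lam\<^sup>2 * (norm (y - x_star))\<^sup>2"
      using minibatch_variance_le[of n p L f, OF p f, of B y x_star] \<open>lam > 0\<close> by (simp add: s \<sigma>_def)
    also have "(norm ((y - x_star) - \<eta> *\<^sub>R grad ?\<psi> y))\<^sup>2 + \<eta>\<^sup>2 * (2 * \<sigma> + s * lam\<^sup>2 * (norm (y - x_star))\<^sup>2)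
        = ((norm ((y - x_star) - \<eta> *\<^sub>R grad ?\<psi> y))\<^sup>2 + \<eta>\<^sup>2 * (s * lam\<^sup>2 * (norm (y - x_star))\<^sup>2)) + 2 * \<eta>\<^sup>2 * \<sigma>"
      by (simp add: algebra_simps)
    also have "\<dots> \<le> (1 - q) * (norm (y - x_star))\<^sup>2 + 2 * \<eta>\<^sup>2 * \<sigma>"
      unfolding q Lt_def[symmetric]
    proof (intro add_right_mono gradient_step_contraction)
      show "(norm (grad ?\<psi> y))\<^sup>2 + lam * Lt * (norm (y - x_star))\<^sup>2 \<le> (Lt + lam) * inner (grad ?\<psi> y) (y - x_star)"
        using smooth_strongly_convex_gradient[OF sc lip, of y x_star] unfolding grad_star by simp
      show "lam * norm (y - x_star) \<le> norm (grad ?\<psi> y)"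
        using strongly_convex_gradient_expansive[OF sc, of y x_star] unfolding grad_star by simp
      show "\<eta> \<le> 2 / ((s + 1) * (Lt + lam))"
        using step by (simp add: Lt_def)
    qed fact+
    finally show ?thesis by (simp add: mult_left_mono)
  qed

  \<comment> \<open>There are only finitely many batches, and their product space is discrete, so
    the whole batch is a single finitely valued variable.\<close>
  define I where "I = PiE {1..B} (\<lambda>_. {1..n})"
  have "finite I" by (simp add: I_def finite_PiE)
  have N: "PiM {1..B} (\<lambda>_. count_space {1..n}) = count_space I"
    unfolding I_def by (rule count_space_PiM_finite) auto
  have k': "k \<in> {1..k}" using k by simp
  have "(\<lambda>\<omega>. \<lambda>l\<in>{1..k}. x l \<omega>) \<in> measurable M (PiM {1..k} (\<lambda>_. borel))"
    using indep by (simp add: indep_rv_def)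
  from measurable_compose[OF this measurable_component_singleton[OF k']]
  have x_meas: "x k \<in> borel_measurable M"
    using k' by simp
  have T_lip: "\<exists>C. C-lipschitz_on UNIV (T i)" if "i \<in> I" for i
  proof -
    have "T i = (\<lambda>y. y - \<eta> *\<^sub>R (minibatch_gradient n B p f i y + grad h y) - x_star)"
      by (simp add: T_def fun_eq_iff)
    moreover have "i j \<in> {1..n}" if "j \<in> {1..B}" for j
      using \<open>i \<in> I\<close> that unfolding I_def by (rule PiE_mem)
    ultimately show ?thesis
      using minibatch_update_lipschitz[where i = i and L = L, OF f h, where p = p and \<eta> = \<eta> and c = x_star]
      by (simp only:)
  qed
  have T_meas: "T i \<in> borel_measurable borel" if "i \<in> I" for i
    using T_lip[OF that] by (auto intro: borel_measurable_continuous_onI lipschitz_on_continuous_on)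
  have restrict: "T (\<lambda>j\<in>{1..B}. i j) y = T i y" for i y
    by (simp only: T_def minibatch_gradient_restrict)
  \<comment> \<open>The argument \<open>z\<close> stands for the history
    \<open>x 1, ..., x k\<close>, since independence is given with respect to all of it; only the
    entry \<open>z k\<close> enters.\<close>
  define \<Phi> where "\<Phi> i z = (norm (T i (z k)))\<^sup>2" for i and z :: "nat \<Rightarrow> 'a"
  define C where "C z = (1 - q) * (norm (z k - x_star))\<^sup>2 + 2 * \<eta>\<^sup>2 * \<sigma>" for z :: "nat \<Rightarrow> 'a"
  have \<Phi>_meas: "\<Phi> i \<in> borel_measurable (PiM {1..k} (\<lambda>_. borel))" if "i \<in> I" for i
  proof -
    have "(\<lambda>z. T i (z k)) \<in> borel_measurable (PiM {1..k} (\<lambda>_. borel))"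
      using measurable_compose[OF measurable_component_singleton[OF k'] T_meas[OF that]] .
    then show ?thesis unfolding \<Phi>_def by measurable
  qed
  have \<Phi>_int: "integrable M (\<lambda>\<omega>. \<Phi> i (\<lambda>l\<in>{1..k}. x l \<omega>))" if "i \<in> I" for i
    using T_lip[OF that] integrable_lipschitz_norm_sq[OF finite_measure_axioms x_meas _ int] k'
    by (auto simp: \<Phi>_def)
  have C_int: "integrable M (\<lambda>\<omega>. C (\<lambda>l\<in>{1..k}. x l \<omega>))"
    using int k' by (simp add: C_def)
  have bound: "expectation (\<lambda>\<omega>. \<Phi> (\<lambda>j\<in>{1..B}. \<xi> k j \<omega>) z) \<le> C z" for z
    unfolding \<Phi>_def C_def restrict by (rule T_bound)
  have x_next: "(norm (x (k + 1) \<omega> - x_star))\<^sup>2 = \<Phi> (\<lambda>j\<in>{1..B}. \<xi> k j \<omega>) (\<lambda>l\<in>{1..k}. x l \<omega>)"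
    if "\<omega> \<in> space M" for \<omega>
    unfolding \<Phi>_def restrict using rec[OF that] k' by simp
  note step_le = indep_rv_expectation_le[OF \<open>finite I\<close> indep[unfolded N], where \<Phi> = \<Phi> and C = C, OF \<Phi>_meas \<Phi>_int bound C_int]
  show "integrable M (\<lambda>\<omega>. (norm (x (k + 1) \<omega> - x_star))\<^sup>2)"
    using step_le(1) by (subst Bochner_Integration.integrable_cong[OF refl x_next]) auto
  have "expectation (\<lambda>\<omega>. (norm (x (k + 1) \<omega> - x_star))\<^sup>2) \<le> expectation (\<lambda>\<omega>. C (\<lambda>l\<in>{1..k}. x l \<omega>))"
    using step_le(2) by (subst Bochner_Integration.integral_cong[OF refl x_next]) auto
  also have "\<dots> = (1 - q) * expectation (\<lambda>\<omega>. (norm (x k \<omega> - x_star))\<^sup>2) + 2 * \<eta>\<^sup>2 * \<sigma>"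
    using int k' by (simp add: C_def prob_space)
  finally show "expectation (\<lambda>\<omega>. (norm (x (k + 1) \<omega> - x_star))\<^sup>2)
      \<le> (1 - q) * expectation (\<lambda>\<omega>. (norm (x k \<omega> - x_star))\<^sup>2)
        + 2 * \<eta>\<^sup>2 * minibatch_variance n B p f x_star"
    by (simp add: \<sigma>_def)
qed

text \<open>By the arithmetic-geometric mean inequality \<open>4 * lam * L \<le> (L + lam)\<^sup>2\<close>, so the step size
  bound even gives \<open>q \<le> 1 / (s + 1)\<close>.\<close>
lemma contraction_factor_bounds:
  fixes lam L s \<eta> :: real
  assumes pos: "0 < lam" "0 < L" "0 < s" "0 < \<eta>" and step: "\<eta> \<le> 2 / ((s + 1) * (L + lam))"
  shows "2 * \<eta> * lam * L / (L + lam) \<in> {0<..<1}"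
proof -
  have "\<eta> * ((s + 1) * (L + lam)) \<le> 2"
    using step pos by (simp add: pos_le_divide_eq)
  \<comment> \<open>Strictness comes from \<open>0 < s\<close>; with \<open>s = 0\<close>,
    \<open>L = lam\<close> and the largest step, the factor would be exactly 1.\<close>
  moreover have "\<eta> * (L + lam) < \<eta> * ((s + 1) * (L + lam))"
    using pos by (intro mult_strict_left_mono) simp_all
  ultimately have "\<eta> * (L + lam) < 2" by linarith
  then have "\<eta> * (L + lam) * (L + lam) < 2 * (L + lam)"
    using pos by (intro mult_strict_right_mono) auto
  moreover have "4 * lam * L \<le> (L + lam) * (L + lam)"
    using zero_le_power2[of "L - lam"] by (simp add: power2_eq_square algebra_simps)
  then have "\<eta> * (4 * lam * L) \<le> \<eta> * ((L + lam) * (L + lam))"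
    using pos by (intro mult_left_mono) auto
  ultimately have "2 * \<eta> * lam * L < L + lam"
    by (simp add: mult.assoc)
  then show ?thesis
    using pos by (simp add: pos_divide_less_eq)
qed

theorem theorem3p1:
  fixes n B K :: nat
    and f :: "nat \<Rightarrow> real ^ 'd \<Rightarrow> real"
    and h F \<psi> :: "real ^ 'd \<Rightarrow> real"
    and L p :: "nat \<Rightarrow> real"
    and L\<^sub>h lam s\<^sub>F \<sigma>\<^sub>F \<eta> q R :: real
    and x\<^sub>1 x_star :: "real ^ 'd"
    and M :: "'w measure"
    and \<xi> :: "nat \<Rightarrow> nat \<Rightarrow> 'w \<Rightarrow> nat"
    and x :: "nat \<Rightarrow> 'w \<Rightarrow> real ^ 'd"
  assumes "n \<ge> 1" and "B \<ge> 1" and "K \<ge> 1"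
    and "\<And>i. i \<in> {1..n} \<Longrightarrow> cont_diff (f i)" and "cont_diff h"
    and F_eq: "F = (\<lambda>y. (1 / real n) * (\<Sum>i=1..n. f i y))"
    and psi_eq: "\<psi> = (\<lambda>y. F y + h y)"
    and "\<And>i. i \<in> {1..n} \<Longrightarrow> L i > 0" and "L\<^sub>h > 0" and "lam > 0"
    and "\<And>i. i \<in> {1..n} \<Longrightarrow> smooth_fun (L i) (f i)"
    and "smooth_fun L\<^sub>h h"
    and "strongly_convex lam \<psi>"
    and "is_arg_min \<psi> (\<lambda>_. True) x_star"
    and "\<And>i. i \<in> {1..n} \<Longrightarrow> p i > 0" and "(\<Sum>i=1..n. p i) = 1"
    and s_eq: "s\<^sub>F = 2 / (real B * lam\<^sup>2 * real n) * (\<Sum>i=1..n. (L i)\<^sup>2 / (real n * p i))"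
    and sigma_eq: "\<sigma>\<^sub>F = 1 / real B *
          (1 / real n * (\<Sum>i=1..n. 1 / (real n * p i) * (norm (grad (f i) x_star))\<^sup>2)
           - (norm (grad F x_star))\<^sup>2)"
    and "minibatch_sgd M n B K p \<eta> f h x\<^sub>1 \<xi> x"
    and "0 < \<eta>"
    and "\<eta> \<le> 2 / ((s\<^sub>F + 1) * (1 / real n * (\<Sum>i=1..n. L i) + L\<^sub>h + lam))"
    and q_eq: "q = 2 * \<eta> * lam * (1 / real n * (\<Sum>i=1..n. L i) + L\<^sub>h)
                 / (1 / real n * (\<Sum>i=1..n. L i) + L\<^sub>h + lam)"
    and R_eq: "R = 2 * \<eta>\<^sup>2 * \<sigma>\<^sub>F / q"
  shows "q \<in> {0<..<1} \<and>
         integrable M (\<lambda>\<omega>. (norm (x (K + 1) \<omega> - x_star))\<^sup>2) \<and>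
         (LINT \<omega>|M. (norm (x (K + 1) \<omega> - x_star))\<^sup>2)
           \<le> (1 - q) ^ K * (norm (x\<^sub>1 - x_star))\<^sup>2 + R"
proof -
  define Lt where "Lt = 1 / real n * (\<Sum>i=1..n. L i) + L\<^sub>h"
  have f: "\<And>i. i \<in> {1..n} \<Longrightarrow> smooth_fun (L i) (f i)" and p: "\<And>i. i \<in> {1..n} \<Longrightarrow> p i > 0" "(\<Sum>i=1..n. p i) = 1"
    and L: "\<And>i. i \<in> {1..n} \<Longrightarrow> L i > 0"
    and sgd: "minibatch_sgd M n B K p \<eta> f h x\<^sub>1 \<xi> x"
    by fact+
  interpret prob_space M
    using sgd by (simp add: minibatch_sgd_def)
  have \<psi>: "\<psi> = (\<lambda>y. (1 / real n) * (\<Sum>i=1..n. f i y) + h y)"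
    by (simp add: psi_eq F_eq)
  have "grad F x_star = (1 / real n) *\<^sub>R (\<Sum>i=1..n. grad (f i) x_star)"
    unfolding F_eq by (intro grad_eqI GDERIV_scaled_sum finite_atLeastAtMost smooth_fun_GDERIV[OF f])
  then have \<sigma>: "\<sigma>\<^sub>F = minibatch_variance n B p f x_star"
    by (simp add: sigma_eq minibatch_variance_def)
  then have "\<sigma>\<^sub>F \<ge> 0"
    using minibatch_variance_nonneg[of n p, OF p] by simp
  have "(\<Sum>i=1..n. L i) > 0" "(\<Sum>i=1..n. (L i)\<^sup>2 / (real n * p i)) > 0"
    using L p(1) \<open>n \<ge> 1\<close> by (intro sum_pos; force)+
  then have "Lt > 0" "s\<^sub>F > 0"
    using \<open>n \<ge> 1\<close> \<open>B \<ge> 1\<close> \<open>L\<^sub>h > 0\<close> \<open>lam > 0\<close> by (auto simp: Lt_def s_eq intro!: add_pos_pos divide_pos_pos mult_pos_pos)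
  then have q: "q \<in> {0<..<1}"
    using contraction_factor_bounds[of lam Lt s\<^sub>F \<eta>] \<open>lam > 0\<close> \<open>0 < \<eta>\<close>
      \<open>\<eta> \<le> 2 / ((s\<^sub>F + 1) * (1 / real n * (\<Sum>i=1..n. L i) + L\<^sub>h + lam))\<close>
    by (simp add: q_eq Lt_def)
  then have R: "2 * \<eta>\<^sup>2 * minibatch_variance n B p f x_star = q * R" "R \<ge> 0"
    using \<open>\<sigma>\<^sub>F \<ge> 0\<close> by (simp_all add: R_eq \<sigma>)
  have step: "integrable M (\<lambda>\<omega>. (norm (x (k + 1) \<omega> - x_star))\<^sup>2) \<and>
      expectation (\<lambda>\<omega>. (norm (x (k + 1) \<omega> - x_star))\<^sup>2)
        \<le> (1 - q) * expectation (\<lambda>\<omega>. (norm (x k \<omega> - x_star))\<^sup>2) + q * R"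
    if "k \<in> {1..K}" "integrable M (\<lambda>\<omega>. (norm (x k \<omega> - x_star))\<^sup>2)" for k
    using minibatch_sgd_step[OF \<open>n \<ge> 1\<close> \<open>B \<ge> 1\<close> that(1) f \<open>smooth_fun L\<^sub>h h\<close>
        \<open>strongly_convex lam \<psi>\<close>[unfolded \<psi>] \<open>is_arg_min \<psi> (\<lambda>_. True) x_star\<close>[unfolded \<psi>]
        p sgd \<open>0 < \<eta>\<close> \<open>\<eta> \<le> 2 / ((s\<^sub>F + 1) * (1 / real n * (\<Sum>i=1..n. L i) + L\<^sub>h + lam))\<close> s_eq q_eq that(2)]
    unfolding R(1) by blast
  \<comment> \<open>Unrolling the one-step bound accumulates a geometric sum of
    \<open>q * R\<close>, which equals \<open>(1 - (1 - q) ^ k) * R\<close> and vanishes at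
    \<open>k = 0\<close>. The iterate after \<open>k\<close> steps has index
    \<open>k + 1\<close>.\<close>
  have "k \<le> K \<Longrightarrow> integrable M (\<lambda>\<omega>. (norm (x (k + 1) \<omega> - x_star))\<^sup>2) \<and>
      expectation (\<lambda>\<omega>. (norm (x (k + 1) \<omega> - x_star))\<^sup>2)
        \<le> (1 - q) ^ k * (norm (x\<^sub>1 - x_star))\<^sup>2 + (1 - (1 - q) ^ k) * R" for k
  proof (induction k)
    case 0
    have eq: "(norm (x 1 \<omega> - x_star))\<^sup>2 = (norm (x\<^sub>1 - x_star))\<^sup>2" if "\<omega> \<in> space M" for \<omega>
      using sgd that by (simp add: minibatch_sgd_def)
    have "integrable M (\<lambda>\<omega>. (norm (x 1 \<omega> - x_star))\<^sup>2)"
      by (subst Bochner_Integration.integrable_cong[OF refl eq]) auto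
    moreover have "expectation (\<lambda>\<omega>. (norm (x 1 \<omega> - x_star))\<^sup>2) = (norm (x\<^sub>1 - x_star))\<^sup>2"
      by (subst Bochner_Integration.integral_cong[OF refl eq]) (auto simp: prob_space)
    ultimately show ?case by simp
  next
    case (Suc k)
    then have IH: "integrable M (\<lambda>\<omega>. (norm (x (k + 1) \<omega> - x_star))\<^sup>2)"
      "expectation (\<lambda>\<omega>. (norm (x (k + 1) \<omega> - x_star))\<^sup>2)
        \<le> (1 - q) ^ k * (norm (x\<^sub>1 - x_star))\<^sup>2 + (1 - (1 - q) ^ k) * R"
      by simp_all
    have "(1 - q) * expectation (\<lambda>\<omega>. (norm (x (k + 1) \<omega> - x_star))\<^sup>2)
        \<le> (1 - q) * ((1 - q) ^ k * (norm (x\<^sub>1 - x_star))\<^sup>2 + (1 - (1 - q) ^ k) * R)"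
      using q IH(2) by (intro mult_left_mono) auto
    also have "\<dots> + q * R = (1 - q) ^ Suc k * (norm (x\<^sub>1 - x_star))\<^sup>2 + (1 - (1 - q) ^ Suc k) * R"
      by (simp add: algebra_simps)
    finally show ?case
      using step[OF _ IH(1)] Suc.prems by auto
  qed
  \<comment> \<open>Here \<open>R \<ge> 0\<close> enters, which rests on the nonnegativity of the
    variance at \<open>x_star\<close>.\<close>
  moreover have "(1 - (1 - q) ^ K) * R \<le> 1 * R"
    using q R(2) by (intro mult_right_mono) auto
  ultimately show ?thesis
    using q by force
qed

end
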